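(* Let $\alpha:X\to\mathcal{CM}X$ and let $\alpha^*=\bigvee_{n\in\mathbb{N}}(\alpha\vee1_X)^n$ (in the Kleisli category of $\mathcal{CM}$, as described in the context). Then for all $x\in X$ and $\psi\in\mathcal{M}X$: $x\Rightarrow_\alpha\psi$ if and only if $\psi\in\alpha^*(x)$.
   Context: $\mathcal{M}X$: finitely supported $\phi:X\to[0,\infty)$, written $\sum_x\phi(x)\cdot x$, with pointwise operations. $\mathcal{CM}X$: non-empty convex subsets of $\mathcal{M}X$ (convex: closed under $\sum a_i\phi_i$ with $a_i\ge0$, $\sum a_i=1$). Kleisli composition of $f:X\to\mathcal{CM}Y$, $g:Y\to\mathcal{CM}Z$: $g\cdot f(x)=\bigcup_{\phi\in f(x)}\sum_{y\in\mathrm{supp}(\phi)}\{\phi(y)\cdot\psi\mid\psi\in g(y)\}$ (Minkowski sums); identity $1_X(x)=\{1\cdot x\}$; powers are w.r.t. this composition. Joins of a non-empty family of Kleisli morphisms: $(\bigvee_if_i)(x)$ is the convex closure of $\bigcup_if_i(x)$. Relations $\Rightarrow^n_\alpha\subseteq X\times\mathcal{M}X$: $\Rightarrow^0_\alpha=\{(x,1\cdot x)\}$; if $\psi=r_1\cdot x_1+\dots+r_k\cdot x_k\in\alpha(x)$, $x_i\Rightarrow^n_\alpha\psi_i$ for each $i$, and $x\Rightarrow^n_\alpha\psi'$, then $x\Rightarrow^{n+1}_\alpha p\cdot(r_1\psi_1+\dots+r_k\psi_k)+(1-p)\cdot\psi'$ for every $p\in[0,1]$. $\Rightarrow_\alpha=\bigcup_n\Rightarrow^n_\alpha$.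 *)

theory Defs
  imports
    "HOL-Analysis.Analysis"
    "HOL-Analysis.Finite_Function_Topology"
    "HOL-Library.Set_Algebras"
begin

text \<open>
  Finitely supported functions are modelled by \<^typ>\<open>'a \<Rightarrow>\<^sub>0 real\<close>, which is a real vector space under
  the pointwise operations, so that the library notions of convexity apply. The sets below are
  carriers: \<^term>\<open>FM\<close> is the set of nonnegative finitely supported functions, \<^term>\<open>CM\<close> the set of
  its non-empty convex subsets.
\<close>

definition FM :: "('a \<Rightarrow>\<^sub>0 real) set" where
  "FM = {\<phi>. \<forall>x. 0 \<le> Poly_Mapping.lookup \<phi> x}"

definition CM :: "('a \<Rightarrow>\<^sub>0 real) set set" where
  "CM = {A. A \<subseteq> FM \<and> A \<noteq> {} \<and> convex A}"

definition kleisli_id :: "'a \<Rightarrow> ('a \<Rightarrow>\<^sub>0 real) set" where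
  "kleisli_id x = {Poly_Mapping.single x 1}"

text \<open>The sum below is a sum of sets, i.e. a Minkowski sum; over the empty support it is \<open>{0}\<close>.\<close>

definition kleisli_comp ::
    "('b \<Rightarrow> ('c \<Rightarrow>\<^sub>0 real) set) \<Rightarrow> ('a \<Rightarrow> ('b \<Rightarrow>\<^sub>0 real) set) \<Rightarrow> 'a \<Rightarrow> ('c \<Rightarrow>\<^sub>0 real) set" where
  "kleisli_comp g f x =
     (\<Union>\<phi>\<in>f x. \<Sum>y\<in>Poly_Mapping.keys \<phi>. {Poly_Mapping.lookup \<phi> y *\<^sub>R \<psi> | \<psi>. \<psi> \<in> g y})"

primrec kleisli_pow ::
    "('a \<Rightarrow> ('a \<Rightarrow>\<^sub>0 real) set) \<Rightarrow> nat \<Rightarrow> 'a \<Rightarrow> ('a \<Rightarrow>\<^sub>0 real) set" where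
  "kleisli_pow f 0 = kleisli_id"
| "kleisli_pow f (Suc n) = kleisli_comp (kleisli_pow f n) f"

text \<open>Only meaningful for non-empty families \<open>F\<close>.\<close>

definition kleisli_join ::
    "('a \<Rightarrow> ('b \<Rightarrow>\<^sub>0 real) set) set \<Rightarrow> 'a \<Rightarrow> ('b \<Rightarrow>\<^sub>0 real) set" where
  "kleisli_join F x = convex hull (\<Union>f\<in>F. f x)"

definition kleisli_star ::
    "('a \<Rightarrow> ('a \<Rightarrow>\<^sub>0 real) set) \<Rightarrow> 'a \<Rightarrow> ('a \<Rightarrow>\<^sub>0 real) set" where
  "kleisli_star \<alpha> = kleisli_join (range (kleisli_pow (kleisli_join {\<alpha>, kleisli_id})))"

text \<open>
  In the rule \<open>step\<close> the element of \<open>\<alpha> x\<close> is given by an arbitrary presentation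
  \<open>r\<^sub>1 \<cdot> x\<^sub>1 + \<dots> + r\<^sub>k \<cdot> x\<^sub>k\<close> with nonnegative coefficients (indices shifted to \<open>0, \<dots>, k - 1\<close>);
  the points \<open>x\<^sub>i\<close> need not be distinct, and \<open>k = 0\<close> presents the zero function.
\<close>

inductive weak_steps ::
    "('a \<Rightarrow> ('a \<Rightarrow>\<^sub>0 real) set) \<Rightarrow> nat \<Rightarrow> 'a \<Rightarrow> ('a \<Rightarrow>\<^sub>0 real) \<Rightarrow> bool"
  for \<alpha> :: "'a \<Rightarrow> ('a \<Rightarrow>\<^sub>0 real) set" where
  zero: "weak_steps \<alpha> 0 x (Poly_Mapping.single x 1)"
| step: "\<lbrakk>(\<Sum>i<(k::nat). Poly_Mapping.single (xs i) (r i)) \<in> \<alpha> x;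
    \<forall>i<k. 0 \<le> r i;
    \<forall>i<k. weak_steps \<alpha> n (xs i) (\<psi> i);
    weak_steps \<alpha> n x \<psi>';
    0 \<le> p; p \<le> 1\<rbrakk>
   \<Longrightarrow> weak_steps \<alpha> (Suc n) x (p *\<^sub>R (\<Sum>i<k. r i *\<^sub>R \<psi> i) + (1 - p) *\<^sub>R \<psi>')"

definition weak_trans ::
    "('a \<Rightarrow> ('a \<Rightarrow>\<^sub>0 real) set) \<Rightarrow> 'a \<Rightarrow> ('a \<Rightarrow>\<^sub>0 real) \<Rightarrow> bool" where
  "weak_trans \<alpha> x \<psi> \<longleftrightarrow> (\<exists>n. weak_steps \<alpha> n x \<psi>)"

end

theory Submission
  imports Defs
begin

text \<open>
  Write \<open>\<beta> = \<alpha> \<or> 1\<close>. By induction on \<open>n\<close>, the set of \<open>n\<close>-step weak derivatives of \<open>x\<close> is exactly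
  \<open>\<beta>\<^sup>n x\<close>: an element of \<open>\<beta> x\<close> has the form \<open>p \<phi> + (1 - p) x\<close> with \<open>\<phi> \<in> \<alpha> x\<close>, and convexity of
  \<open>\<beta>\<^sup>n y\<close> allows repeated occurrences of a point \<open>y\<close> in a presentation to be merged into one.
  Weak derivatives persist from \<open>n\<close> to \<open>n + 1\<close> (take \<open>p = 0\<close>), so \<open>\<alpha>\<^sup>*\<close> is a join of an increasing
  chain of convex sets, for which the convex closure is superfluous.
\<close>

section \<open>Convex combinations and finitely supported functions\<close>

text \<open>Dividing the coefficients by their total turns the sum into a convex combination. If the
  total is 0, every coefficient vanishes and any point of \<open>C\<close> serves, whence the
  nonemptiness assumption.\<close>

lemma convex_cone_sum:
  fixes C :: "'v::real_vector set"
  assumes "convex C" "C \<noteq> {}" "finite I"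
    and "\<And>i. i \<in> I \<Longrightarrow> 0 \<le> c i" "\<And>i. i \<in> I \<Longrightarrow> v i \<in> C"
  shows "\<exists>w\<in>C. (\<Sum>i\<in>I. c i *\<^sub>R v i) = (\<Sum>i\<in>I. c i) *\<^sub>R w"
proof (cases "sum c I = 0")
  case True
  then have "\<forall>i\<in>I. c i = 0"
    using assms by (simp add: sum_nonneg_eq_0_iff)
  then show ?thesis
    using True assms(2) by auto
next
  case False
  let ?w = "\<Sum>i\<in>I. (c i / sum c I) *\<^sub>R v i"
  have "?w \<in> C"
    using assms False
    by (intro convex_sum) (auto simp: sum_nonneg simp flip: sum_divide_distrib)
  moreover have "(\<Sum>i\<in>I. c i *\<^sub>R v i) = sum c I *\<^sub>R ?w"
    using False by (simp add: scaleR_sum_right)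
  ultimately show ?thesis
    by blast
qed

lemma lookup_scaleR [simp]:
  fixes \<phi> :: "'b \<Rightarrow>\<^sub>0 'v::real_vector"
  shows "Poly_Mapping.lookup (a *\<^sub>R \<phi>) y = a *\<^sub>R Poly_Mapping.lookup \<phi> y"
proof -
  have "finite {i. a *\<^sub>R Poly_Mapping.lookup \<phi> i \<noteq> 0}"
    by (rule finite_subset[OF _ finite_lookup[of \<phi>]]) auto
  then show ?thesis
    by (simp add: scaleR_poly_mapping_def Abs_poly_mapping_inverse)
qed

lemma sum_keys_lookup:
  fixes \<psi> :: "'b \<Rightarrow> 'v::real_vector"
  assumes "finite K" "Poly_Mapping.keys \<phi> \<subseteq> K"
  shows "(\<Sum>y\<in>Poly_Mapping.keys \<phi>. Poly_Mapping.lookup \<phi> y *\<^sub>R \<psi> y)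
       = (\<Sum>y\<in>K. Poly_Mapping.lookup \<phi> y *\<^sub>R \<psi> y)"
  using assms by (intro sum.mono_neutral_left) (auto simp: in_keys_iff)

lemma sum_single_lookup:
  fixes \<phi> :: "'b \<Rightarrow>\<^sub>0 real"
  assumes "finite K" "Poly_Mapping.keys \<phi> \<subseteq> K"
  shows "(\<Sum>y\<in>K. Poly_Mapping.single y (Poly_Mapping.lookup \<phi> y)) = \<phi>"
proof (rule poly_mapping_eqI)
  fix y
  show "Poly_Mapping.lookup (\<Sum>y\<in>K. Poly_Mapping.single y (Poly_Mapping.lookup \<phi> y)) y
      = Poly_Mapping.lookup \<phi> y"
    using assms by (auto simp: lookup_sum lookup_single when_def in_keys_iff)
qed

section \<open>Kleisli composition\<close>

text \<open>Trades the Minkowski sum for a choice function \<open>\<psi>\<close>. Nonemptiness of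
  every \<open>g y\<close> lets the choice be total, so that \<psi> can later be used at points off
  the support.\<close>

lemma mem_kleisli_comp_iff:
  assumes "\<And>y. g y \<noteq> {}"
  shows "v \<in> kleisli_comp g f x \<longleftrightarrow>
    (\<exists>\<phi>\<in>f x. \<exists>\<psi>. (\<forall>y. \<psi> y \<in> g y) \<and>
       v = (\<Sum>y\<in>Poly_Mapping.keys \<phi>. Poly_Mapping.lookup \<phi> y *\<^sub>R \<psi> y))" (is "?L \<longleftrightarrow> ?R")
proof
  assume ?L
  then obtain \<phi> s where \<phi>: "\<phi> \<in> f x" and v: "v = sum s (Poly_Mapping.keys \<phi>)"
    and s: "\<forall>y\<in>Poly_Mapping.keys \<phi>. \<exists>\<psi>\<in>g y. s y = Poly_Mapping.lookup \<phi> y *\<^sub>R \<psi>"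
    unfolding kleisli_comp_def by (auto simp: set_sum_alt) blast
  have "\<forall>y. \<exists>\<psi>\<in>g y. y \<in> Poly_Mapping.keys \<phi> \<longrightarrow> s y = Poly_Mapping.lookup \<phi> y *\<^sub>R \<psi>"
    using s assms by blast
  then obtain \<psi> where "\<forall>y. \<psi> y \<in> g y \<and>
      (y \<in> Poly_Mapping.keys \<phi> \<longrightarrow> s y = Poly_Mapping.lookup \<phi> y *\<^sub>R \<psi> y)"
    by metis
  then show ?R
    using \<phi> v by (intro bexI[of _ \<phi>] exI[of _ \<psi>]) auto
next
  assume ?R
  then obtain \<phi> \<psi> where "\<phi> \<in> f x" "\<forall>y. \<psi> y \<in> g y"
    "v = (\<Sum>y\<in>Poly_Mapping.keys \<phi>. Poly_Mapping.lookup \<phi> y *\<^sub>R \<psi> y)"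
    by blast
  then show ?L
    unfolding kleisli_comp_def by (fastforce simp: set_sum_alt)
qed

text \<open>Group the indices by the value of \<open>xs\<close>. On each fibre, convexity of
  \<open>g y\<close> merges the chosen \<open>\<psi> i\<close> into a single element of
  \<open>g y\<close> whose weight is the total weight of the fibre.\<close>

lemma kleisli_compI:
  assumes g: "\<And>y. g y \<noteq> {}" "\<And>y. convex (g y)"
    and I: "finite I" "(\<Sum>i\<in>I. Poly_Mapping.single (xs i) (r i)) \<in> f x"
    and r: "\<And>i. i \<in> I \<Longrightarrow> 0 \<le> r i" and \<psi>: "\<And>i. i \<in> I \<Longrightarrow> \<psi> i \<in> g (xs i)"
  shows "(\<Sum>i\<in>I. r i *\<^sub>R \<psi> i) \<in> kleisli_comp g f x"
proof -
  define \<phi> where "\<phi> = (\<Sum>i\<in>I. Poly_Mapping.single (xs i) (r i))"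
  have lookup: "Poly_Mapping.lookup \<phi> y = (\<Sum>i\<in>{i \<in> I. xs i = y}. r i)" for y
    unfolding \<phi>_def using I(1)
    by (simp add: lookup_sum lookup_single when_def sum.inter_filter)
  have keys: "Poly_Mapping.keys \<phi> \<subseteq> xs ` I"
  proof
    fix y assume "y \<in> Poly_Mapping.keys \<phi>"
    then have "{i \<in> I. xs i = y} \<noteq> {}"
      by (metis in_keys_iff lookup sum.empty)
    then show "y \<in> xs ` I" by auto
  qed
  have "\<forall>y. \<exists>w\<in>g y. (\<Sum>i\<in>{i \<in> I. xs i = y}. r i *\<^sub>R \<psi> i) = Poly_Mapping.lookup \<phi> y *\<^sub>R w"
    unfolding lookup using assms by (intro allI convex_cone_sum) auto
  then obtain w where w: "\<And>y. w y \<in> g y"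
    "\<And>y. (\<Sum>i\<in>{i \<in> I. xs i = y}. r i *\<^sub>R \<psi> i) = Poly_Mapping.lookup \<phi> y *\<^sub>R w y"
    by metis
  have "(\<Sum>i\<in>I. r i *\<^sub>R \<psi> i) = (\<Sum>y\<in>xs ` I. \<Sum>i\<in>{i \<in> I. xs i = y}. r i *\<^sub>R \<psi> i)"
    using I(1) by (rule sum.image_gen)
  also have "\<dots> = (\<Sum>y\<in>Poly_Mapping.keys \<phi>. Poly_Mapping.lookup \<phi> y *\<^sub>R w y)"
    using I(1) keys by (simp add: w(2) sum_keys_lookup[of "xs ` I"])
  finally show ?thesis
    using I(2) w(1) unfolding mem_kleisli_comp_iff[of g, OF g(1)] \<phi>_def by blast
qed

lemma kleisli_comp_nonempty:
  assumes "\<And>y. g y \<noteq> {}" "f x \<noteq> {}"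
  shows "kleisli_comp g f x \<noteq> {}"
proof -
  obtain \<phi> where "\<phi> \<in> f x"
    using assms(2) by blast
  moreover have "\<forall>y. \<exists>w. w \<in> g y"
    using assms(1) by blast
  then obtain \<psi> where "\<forall>y. \<psi> y \<in> g y"
    by metis
  ultimately have "(\<Sum>y\<in>Poly_Mapping.keys \<phi>. Poly_Mapping.lookup \<phi> y *\<^sub>R \<psi> y)
      \<in> kleisli_comp g f x"
    unfolding mem_kleisli_comp_iff[of g, OF assms(1)] by blast
  then show ?thesis by blast
qed

text \<open>A mixture of two elements is presented over the disjoint union of two copies of a common
  finite set of points. Points in both supports then occur twice, and \<open>kleisli_compI\<close>
  merges them.\<close>

lemma convex_kleisli_comp:
  fixes g :: "'b \<Rightarrow> ('c \<Rightarrow>\<^sub>0 real) set" and f :: "'a \<Rightarrow> ('b \<Rightarrow>\<^sub>0 real) set"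
  assumes g: "\<And>y. g y \<noteq> {}" "\<And>y. convex (g y)" and f: "convex (f x)" "f x \<subseteq> FM"
  shows "convex (kleisli_comp g f x)"
proof (rule convexI)
  fix v1 v2 :: "'c \<Rightarrow>\<^sub>0 real" and a b :: real
  assume v: "v1 \<in> kleisli_comp g f x" "v2 \<in> kleisli_comp g f x"
    and ab: "0 \<le> a" "0 \<le> b" "a + b = 1"
  obtain \<phi>1 \<psi>1 where 1: "\<phi>1 \<in> f x" "\<And>y. \<psi>1 y \<in> g y"
    "v1 = (\<Sum>y\<in>Poly_Mapping.keys \<phi>1. Poly_Mapping.lookup \<phi>1 y *\<^sub>R \<psi>1 y)"
    using v(1) unfolding mem_kleisli_comp_iff[of g, OF g(1)] by blast
  obtain \<phi>2 \<psi>2 where 2: "\<phi>2 \<in> f x" "\<And>y. \<psi>2 y \<in> g y"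
    "v2 = (\<Sum>y\<in>Poly_Mapping.keys \<phi>2. Poly_Mapping.lookup \<phi>2 y *\<^sub>R \<psi>2 y)"
    using v(2) unfolding mem_kleisli_comp_iff[of g, OF g(1)] by blast
  define K where "K = Poly_Mapping.keys \<phi>1 \<union> Poly_Mapping.keys \<phi>2"
  have K: "finite K" "Poly_Mapping.keys \<phi>1 \<subseteq> K" "Poly_Mapping.keys \<phi>2 \<subseteq> K"
    by (auto simp: K_def)
  \<comment> \<open>The Boolean tag records which of the two elements an index comes from;
    \<open>snd\<close> forgets it.\<close>
  define r where "r = (\<lambda>(t, y). if t then a * Poly_Mapping.lookup \<phi>1 y
                                 else b * Poly_Mapping.lookup \<phi>2 y)"
  define \<psi> where "\<psi> = (\<lambda>(t, y). if t then \<psi>1 y else \<psi>2 y)"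
  have sum_split: "(\<Sum>i\<in>UNIV \<times> K. h i) = (\<Sum>y\<in>K. h (True, y)) + (\<Sum>y\<in>K. h (False, y))"
    for h :: "bool \<times> 'b \<Rightarrow> 'v::comm_monoid_add"
    using sum.cartesian_product[of "\<lambda>t y. h (t, y)" K UNIV]
    by (simp add: UNIV_bool add.commute)
  have scale: "(\<Sum>y\<in>K. Poly_Mapping.single y (c * Poly_Mapping.lookup \<phi> y)) = c *\<^sub>R \<phi>"
    if "Poly_Mapping.keys \<phi> \<subseteq> K" for c and \<phi> :: "'b \<Rightarrow>\<^sub>0 real"
  proof -
    have "Poly_Mapping.keys (c *\<^sub>R \<phi>) \<subseteq> K"
      using that by (auto simp: in_keys_iff)
    then show ?thesis
      using sum_single_lookup[OF K(1), of "c *\<^sub>R \<phi>"] by simp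
  qed
  have "(\<Sum>i\<in>UNIV \<times> K. Poly_Mapping.single (snd i) (r i)) = a *\<^sub>R \<phi>1 + b *\<^sub>R \<phi>2"
    by (simp add: sum_split r_def scale K)
  also have "\<dots> \<in> f x"
    using f(1) 1(1) 2(1) ab by (rule convexD)
  finally have f_mem: "(\<Sum>i\<in>UNIV \<times> K. Poly_Mapping.single (snd i) (r i)) \<in> f x" .
  have "0 \<le> Poly_Mapping.lookup \<phi>1 y" "0 \<le> Poly_Mapping.lookup \<phi>2 y" for y
    using 1(1) 2(1) f(2) by (auto simp: FM_def)
  then have "(\<Sum>i\<in>UNIV \<times> K. r i *\<^sub>R \<psi> i) \<in> kleisli_comp g f x"
    using 1(2) 2(2) ab K(1)
    by (intro kleisli_compI[where xs = snd] g f_mem) (auto simp: r_def \<psi>_def)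
  also have "(\<Sum>i\<in>UNIV \<times> K. r i *\<^sub>R \<psi> i) = a *\<^sub>R v1 + b *\<^sub>R v2"
    unfolding 1 2
    by (simp add: sum_split r_def \<psi>_def sum_keys_lookup[OF K(1,2)] sum_keys_lookup[OF K(1,3)]
        scaleR_sum_right)
  finally show "a *\<^sub>R v1 + b *\<^sub>R v2 \<in> kleisli_comp g f x" .
qed

text \<open>The recursion for powers keeps \<open>f\<close> itself as the inner morphism, so the
  nonnegativity demanded by \<open>convex_kleisli_comp\<close> comes straight from
  \<open>f x \<in> CM\<close>.\<close>

lemma kleisli_pow_convex_nonempty:
  assumes "\<And>x. f x \<in> CM"
  shows "convex (kleisli_pow f n x) \<and> kleisli_pow f n x \<noteq> {}"
proof (induction n arbitrary: x)
  case 0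
  then show ?case
    by (simp add: kleisli_id_def)
next
  case (Suc n)
  then have "convex (kleisli_comp (kleisli_pow f n) f x)"
    using assms[of x] by (intro convex_kleisli_comp) (auto simp: CM_def)
  moreover have "kleisli_comp (kleisli_pow f n) f x \<noteq> {}"
    using Suc assms[of x] by (intro kleisli_comp_nonempty) (auto simp: CM_def)
  ultimately show ?case
    by simp
qed

section \<open>Join with the identity\<close>

text \<open>As \<open>\<alpha> x\<close> is convex, its hull with one more point is the union of the
  segments to that point. The parameter \<open>p\<close> is the one of the rule
  \<open>step\<close>.\<close>

lemma kleisli_join_id:
  assumes "\<alpha> x \<in> CM"
  shows "kleisli_join {\<alpha>, kleisli_id} x =
    {p *\<^sub>R \<phi> + (1 - p) *\<^sub>R Poly_Mapping.single x 1 | p \<phi>. 0 \<le> p \<and> p \<le> 1 \<and> \<phi> \<in> \<alpha> x}"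
proof -
  have "kleisli_join {\<alpha>, kleisli_id} x = convex hull (insert (Poly_Mapping.single x 1) (\<alpha> x))"
    by (simp add: kleisli_join_def kleisli_id_def)
  also have "\<dots> = {u *\<^sub>R Poly_Mapping.single x 1 + v *\<^sub>R \<phi> | u v \<phi>.
      0 \<le> u \<and> 0 \<le> v \<and> u + v = 1 \<and> \<phi> \<in> \<alpha> x}"
    using assms by (subst convex_hull_insert) (auto simp: CM_def hull_same)
  also have "\<dots> = {p *\<^sub>R \<phi> + (1 - p) *\<^sub>R Poly_Mapping.single x 1 | p \<phi>.
      0 \<le> p \<and> p \<le> 1 \<and> \<phi> \<in> \<alpha> x}" (is "?A = ?B")
  proof (intro equalityI subsetI)
    fix v assume "v \<in> ?A"
    then obtain u p \<phi> where "v = u *\<^sub>R Poly_Mapping.single x 1 + p *\<^sub>R \<phi>"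
      "0 \<le> u" "0 \<le> p" "u + p = 1" "\<phi> \<in> \<alpha> x" by blast
    moreover from this have "u = 1 - p" by simp
    ultimately show "v \<in> ?B"
      by (auto simp: add.commute)
  next
    fix v assume "v \<in> ?B"
    then obtain p \<phi> where "v = p *\<^sub>R \<phi> + (1 - p) *\<^sub>R Poly_Mapping.single x 1"
      "0 \<le> p" "p \<le> 1" "\<phi> \<in> \<alpha> x" by blast
    then show "v \<in> ?A"
      by (intro CollectI exI[of _ "1 - p"] exI[of _ p] exI[of _ \<phi>]) (auto simp: add.commute)
  qed
  finally show ?thesis .
qed

lemma kleisli_join_id_CM:
  assumes "\<alpha> x \<in> CM"
  shows "kleisli_join {\<alpha>, kleisli_id} x \<in> CM"
proof -
  have "kleisli_join {\<alpha>, kleisli_id} x \<subseteq> FM"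
    using assms unfolding kleisli_join_id[of \<alpha>, OF assms]
    by (auto simp: CM_def FM_def subset_iff lookup_add lookup_single when_def)
  moreover have "kleisli_join {\<alpha>, kleisli_id} x \<noteq> {}"
    by (simp add: kleisli_join_def kleisli_id_def)
  ultimately show ?thesis
    by (simp add: CM_def kleisli_join_def)
qed

section \<open>Weak derivatives and powers\<close>

lemma weak_steps_0_iff: "weak_steps \<alpha> 0 x \<psi> \<longleftrightarrow> \<psi> = Poly_Mapping.single x 1"
  by (auto elim: weak_steps.cases intro: weak_steps.zero)

text \<open>The rule \<open>step\<close> for the canonical presentation of \<phi>: enumerating its
  support supplies the indices below \<open>k\<close>.\<close>

lemma weak_steps_keysI:
  assumes "\<phi> \<in> \<alpha> x" "\<phi> \<in> FM" "\<And>y. weak_steps \<alpha> n y (\<psi> y)" "weak_steps \<alpha> n x \<psi>'" "0 \<le> p" "p \<le> 1"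
  shows "weak_steps \<alpha> (Suc n) x
    (p *\<^sub>R (\<Sum>y\<in>Poly_Mapping.keys \<phi>. Poly_Mapping.lookup \<phi> y *\<^sub>R \<psi> y) + (1 - p) *\<^sub>R \<psi>')"
proof -
  define k where "k = card (Poly_Mapping.keys \<phi>)"
  obtain e where "bij_betw e {..<k} (Poly_Mapping.keys \<phi>)"
    unfolding k_def by (metis bij_betw_from_nat_into_finite finite_keys)
  then have reindex: "(\<Sum>i<k. h (e i)) = sum h (Poly_Mapping.keys \<phi>)"
    for h :: "'a \<Rightarrow> 'a \<Rightarrow>\<^sub>0 real"
    by (rule sum.reindex_bij_betw)
  have "(\<Sum>i<k. Poly_Mapping.single (e i) (Poly_Mapping.lookup \<phi> (e i))) = \<phi>"
    using reindex[of "\<lambda>y. Poly_Mapping.single y (Poly_Mapping.lookup \<phi> y)"]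
    by (simp add: sum_single_lookup)
  then have "weak_steps \<alpha> (Suc n) x
      (p *\<^sub>R (\<Sum>i<k. Poly_Mapping.lookup \<phi> (e i) *\<^sub>R \<psi> (e i)) + (1 - p) *\<^sub>R \<psi>')"
    using assms by (intro weak_steps.step[where xs = e]) (auto simp: FM_def)
  then show ?thesis
    using reindex[of "\<lambda>y. Poly_Mapping.lookup \<phi> y *\<^sub>R \<psi> y"] by simp
qed

lemma weak_steps_iff_kleisli_pow:
  assumes \<alpha>: "\<And>x. \<alpha> x \<in> CM"
  shows "weak_steps \<alpha> n x v \<longleftrightarrow> v \<in> kleisli_pow (kleisli_join {\<alpha>, kleisli_id}) n x"
proof (induction n arbitrary: x v)
  case 0
  then show ?case
    by (simp add: weak_steps_0_iff kleisli_id_def)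
next
  case (Suc n)
  let ?\<beta> = "kleisli_join {\<alpha>, kleisli_id}"
  let ?g = "kleisli_pow ?\<beta> n"
  have g: "\<And>y. ?g y \<noteq> {}" "\<And>y. convex (?g y)"
    using kleisli_pow_convex_nonempty[of ?\<beta>, OF kleisli_join_id_CM, OF \<alpha>] by auto
  show ?case
  proof
    assume "weak_steps \<alpha> (Suc n) x v"
    then show "v \<in> kleisli_pow ?\<beta> (Suc n) x"
    proof cases
      case (step xs r k \<psi> \<psi>' p)
      \<comment> \<open>The stationary part becomes one extra summand at index \<open>k\<close>: the
        point \<open>x\<close> with weight \<open>1 - p\<close>, followed by \<open>\<psi>'\<close>.
        It may coincide with some \<open>xs i\<close>, which \<open>kleisli_compI\<close>
        permits.\<close>
      define ys where "ys i = (if i < k then xs i else x)" for i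
      define s where "s i = (if i < k then p * r i else 1 - p)" for i
      define \<xi> where "\<xi> i = (if i < k then \<psi> i else \<psi>')" for i
      have "(\<Sum>i<Suc k. Poly_Mapping.single (ys i) (s i))
          = p *\<^sub>R (\<Sum>i<k. Poly_Mapping.single (xs i) (r i)) + (1 - p) *\<^sub>R Poly_Mapping.single x 1"
        by (rule poly_mapping_eqI)
          (simp add: ys_def s_def lookup_add lookup_sum lookup_single when_def sum_distrib_left
            if_distrib[of "(*) p"] cong: if_cong)
      also have "\<dots> \<in> ?\<beta> x"
        using step unfolding kleisli_join_id[of \<alpha>, OF \<alpha>] by blast
      finally have "(\<Sum>i<Suc k. s i *\<^sub>R \<xi> i) \<in> kleisli_comp ?g ?\<beta> x"
        using step Suc.IH
        by (intro kleisli_compI[where xs = ys] g) (auto simp: s_def ys_def \<xi>_def)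
      also have "(\<Sum>i<Suc k. s i *\<^sub>R \<xi> i) = v"
        unfolding step by (simp add: s_def \<xi>_def scaleR_sum_right)
      finally show ?thesis by simp
    qed
  next
    assume "v \<in> kleisli_pow ?\<beta> (Suc n) x"
    then obtain \<phi> \<psi> where \<phi>: "\<phi> \<in> ?\<beta> x" and \<psi>: "\<And>y. \<psi> y \<in> ?g y"
      and v: "v = (\<Sum>y\<in>Poly_Mapping.keys \<phi>. Poly_Mapping.lookup \<phi> y *\<^sub>R \<psi> y)"
      by (auto simp: mem_kleisli_comp_iff g)
    obtain p \<phi>' where \<phi>': "\<phi>' \<in> \<alpha> x" and p: "0 \<le> p" "p \<le> 1"
      and \<phi>_eq: "\<phi> = p *\<^sub>R \<phi>' + (1 - p) *\<^sub>R Poly_Mapping.single x 1"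
      using \<phi> unfolding kleisli_join_id[of \<alpha>, OF \<alpha>] by blast
    \<comment> \<open>Neither support need contain \<open>x\<close>, yet the summand
      \<open>(1 - p) *\<^sub>R \<psi> x\<close> has to be split off inside the sum.\<close>
    define K where "K = insert x (Poly_Mapping.keys \<phi> \<union> Poly_Mapping.keys \<phi>')"
    have K: "finite K" "x \<in> K" "Poly_Mapping.keys \<phi> \<subseteq> K" "Poly_Mapping.keys \<phi>' \<subseteq> K"
      by (auto simp: K_def)
    have "v = (\<Sum>y\<in>K. Poly_Mapping.lookup \<phi> y *\<^sub>R \<psi> y)"
      unfolding v by (rule sum_keys_lookup[OF K(1,3)])
    also have "\<dots> = (\<Sum>y\<in>K. p *\<^sub>R Poly_Mapping.lookup \<phi>' y *\<^sub>R \<psi> y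
        + (if x = y then (1 - p) *\<^sub>R \<psi> y else 0))"
      by (rule sum.cong)
        (auto simp: \<phi>_eq lookup_add lookup_single when_def scaleR_add_left)
    also have "\<dots> = p *\<^sub>R (\<Sum>y\<in>K. Poly_Mapping.lookup \<phi>' y *\<^sub>R \<psi> y) + (1 - p) *\<^sub>R \<psi> x"
      using K by (simp add: sum.distrib scaleR_sum_right)
    also have "\<dots> = p *\<^sub>R (\<Sum>y\<in>Poly_Mapping.keys \<phi>'. Poly_Mapping.lookup \<phi>' y *\<^sub>R \<psi> y)
        + (1 - p) *\<^sub>R \<psi> x"
      by (simp add: sum_keys_lookup[OF K(1,4)])
    \<comment> \<open>The same choice \<open>\<psi> x\<close> serves both for the mass that \<phi>'
      puts on \<open>x\<close> and as the derivative \<psi>' of the stationary part.\<close>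
    finally show "weak_steps \<alpha> (Suc n) x v"
      using weak_steps_keysI[of \<phi>' \<alpha> x n \<psi> "\<psi> x" p] \<phi>' \<alpha>[of x] \<psi> Suc.IH p
      by (auto simp: CM_def)
  qed
qed

section \<open>The star as an increasing union\<close>

lemma weak_steps_mono:
  assumes \<alpha>: "\<And>x. \<alpha> x \<in> CM" and "m \<le> n" "weak_steps \<alpha> m x v"
  shows "weak_steps \<alpha> n x v"
  using assms(2,3)
proof (induction n rule: dec_induct)
  case (step n)
  \<comment> \<open>Even with \<open>p = 0\<close> the rule \<open>step\<close> asks for a
    derivative at each point of a presentation; nonemptiness of the powers provides one.\<close>
  have "\<forall>y. \<exists>w. weak_steps \<alpha> n y w"
    using kleisli_pow_convex_nonempty[of "kleisli_join {\<alpha>, kleisli_id}", OF kleisli_join_id_CM, OF \<alpha>]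
    by (auto simp: weak_steps_iff_kleisli_pow[of \<alpha>, OF \<alpha>])
  then obtain \<psi> where "\<And>y. weak_steps \<alpha> n y (\<psi> y)"
    by metis
  moreover obtain \<phi> where "\<phi> \<in> \<alpha> x" "\<phi> \<in> FM"
    using \<alpha>[of x] by (auto simp: CM_def)
  ultimately show ?case
    using weak_steps_keysI[of \<phi> \<alpha> x n \<psi> v 0] step by simp
qed

theorem theorem8p9:
  fixes \<alpha> :: "'a \<Rightarrow> ('a \<Rightarrow>\<^sub>0 real) set"
  assumes "\<And>x. \<alpha> x \<in> CM"
  shows "\<forall>x. \<forall>\<psi>\<in>FM. weak_trans \<alpha> x \<psi> \<longleftrightarrow> \<psi> \<in> kleisli_star \<alpha> x"
proof (intro allI ballI)
  fix x and \<psi> :: "'a \<Rightarrow>\<^sub>0 real"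
  define S where "S n = {v. weak_steps \<alpha> n x v}" for n
  have S: "S n = kleisli_pow (kleisli_join {\<alpha>, kleisli_id}) n x" for n
    by (auto simp: S_def weak_steps_iff_kleisli_pow[of \<alpha>, OF assms])
  have conv: "convex (S n)" for n
    using kleisli_pow_convex_nonempty[of "kleisli_join {\<alpha>, kleisli_id}", OF kleisli_join_id_CM,
        OF assms] by (simp add: S)
  have mono: "S m \<subseteq> S n" if "m \<le> n" for m n
    using weak_steps_mono[of \<alpha>, OF assms that] by (auto simp: S_def)
  \<comment> \<open>In an increasing chain, any two points already lie in a common convex
    member.\<close>
  have "convex (\<Union>n. S n)"
  proof (rule convexI)
    fix v w and a b :: real
    assume "v \<in> (\<Union>n. S n)" "w \<in> (\<Union>n. S n)" and ab: "0 \<le> a" "0 \<le> b" "a + b = 1"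
    then obtain m n where "v \<in> S m" "w \<in> S n"
      by blast
    then have "v \<in> S (max m n)" "w \<in> S (max m n)"
      using mono[of m "max m n"] mono[of n "max m n"] by auto
    then show "a *\<^sub>R v + b *\<^sub>R w \<in> (\<Union>n. S n)"
      using convexD[OF conv] ab by blast
  qed
  then have "kleisli_star \<alpha> x = (\<Union>n. S n)"
    by (simp add: kleisli_star_def kleisli_join_def[of "range _"] S hull_same)
  then show "weak_trans \<alpha> x \<psi> \<longleftrightarrow> \<psi> \<in> kleisli_star \<alpha> x"
    by (auto simp: weak_trans_def S_def)
qed

end
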